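(* Let $\varepsilon>0$ and let $(x_j)_{j\ge1}$ be a frame in an infinite-dimensional separable Hilbert space. Then $(x_j)$ has an (infinite) subsequence $(x_{j_k})_{k\ge1}$ which is $(1+\varepsilon)$-equivalent to an orthogonal basis of $\ell_2$.
   Context: A sequence $(x_j)$ in a Hilbert space $H$ is called a frame if there exist positive numbers $A,B$ such that $A\|x\|^2\le\sum_j|\langle x,x_j\rangle|^2\le B\|x\|^2$ for all $x\in H$. $[x_j]$ denotes the closed linear span of $(x_j)$. Two sequences $(x_j)$ and $(y_j)$ in possibly different Banach spaces are $C$-equivalent if there is an isomorphism $T:[x_j]\to[y_j]$ with $Tx_j=y_j$ for all $j$ and $\|T\|\,\|T^{-1}\|\le C$. An orthogonal basis of $\ell_2$ is a sequence of nonzero, pairwise orthogonal vectors (not necessarily normalized) whose closed linear span is $\ell_2$. *)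

theory Defs
  imports "HOL-Analysis.Analysis"
begin

section \<open>Scalars\<close>

text \<open>
  The real and the complex scalar field are treated uniformly: the instances of the following
  class are, up to isometric isomorphism, exactly these two (see \<open>real_or_complex_cases\<close>).
\<close>

class real_or_complex = real_normed_field + banach +
  fixes scnj :: "'a \<Rightarrow> 'a"
  assumes scnj_add: "scnj (a + b) = scnj a + scnj b"
    and scnj_mult: "scnj (a * b) = scnj a * scnj b"
    and mult_scnj_scaleR: "a * scnj a = (norm a)\<^sup>2 *\<^sub>R 1"

instantiation real :: real_or_complex
begin
definition scnj_real :: "real \<Rightarrow> real" where "scnj_real a = a"
instance by standard (auto simp: scnj_real_def power2_eq_square)
end

instantiation complex :: real_or_complex
begin
definition scnj_complex :: "complex \<Rightarrow> complex" where "scnj_complex = cnj"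
instance by standard (auto simp: scnj_complex_def complex_norm_square scaleR_conv_of_real simp flip: of_real_power)
end

lemma mult_scnj: "a * scnj a = of_real ((norm (a::'k::real_or_complex))\<^sup>2)"
  by (simp only: mult_scnj_scaleR of_real_def)

lemma scnj_zero [simp]: "scnj 0 = (0::'k::real_or_complex)"
  using scnj_add[of 0 "0::'k"] by simp

lemma scnj_of_real [simp]: "scnj (of_real r) = (of_real r :: 'k::real_or_complex)"
proof (cases "r = 0")
  case False
  have "of_real r * scnj (of_real r :: 'k) = of_real r * of_real r"
    using mult_scnj[of "of_real r :: 'k"] by (simp add: power2_eq_square)
  with False show ?thesis by simp
qed simp

lemma scnj_minus: "scnj (- a) = - scnj (a::'k::real_or_complex)"
  using scnj_add[of a "- a"] by (simp add: eq_neg_iff_add_eq_0 add.commute)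

lemma norm_scnj [simp]: "norm (scnj a) = norm (a::'k::real_or_complex)"
proof (cases "a = 0")
  case False
  have "norm a * norm (scnj a) = norm a * norm a"
    using arg_cong[OF mult_scnj[of a], of norm] by (simp add: norm_mult power2_eq_square)
  with False show ?thesis by simp
qed simp

lemma scnj_scnj [simp]: "scnj (scnj a) = (a::'k::real_or_complex)"
proof (cases "a = 0")
  case False
  then have "scnj a \<noteq> 0" using norm_scnj[of a] by (metis norm_eq_zero)
  moreover have "scnj a * scnj (scnj a) = scnj a * a"
    using mult_scnj[of "scnj a"] mult_scnj[of a] by (simp add: mult.commute)
  ultimately show ?thesis by simp
qed simp

lemma scnj_fixed_imp_real:
  assumes "scnj a = (a::'k::real_or_complex)" shows "\<exists>r. a = of_real r"
proof -
  have "(a - of_real (norm a)) * (a + of_real (norm a)) = 0"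
    using mult_scnj[of a] assms by (simp add: algebra_simps power2_eq_square)
  then have "a = of_real (norm a) \<or> a = of_real (- norm a)"
    by (auto simp: eq_neg_iff_add_eq_0)
  then show ?thesis by blast
qed

lemma real_or_complex_cases:
  "(\<forall>z::'k::real_or_complex. \<exists>a. z = of_real a) \<or>
   (\<exists>i::'k. i * i = -1 \<and> (\<forall>z. \<exists>a b. z = of_real a + of_real b * i))"
proof (cases "\<forall>z::'k. scnj z = z")
  case True
  then show ?thesis using scnj_fixed_imp_real by blast
next
  case False
  then obtain w :: 'k where w: "scnj w \<noteq> w" by blast
  define v where "v = w - scnj w"
  have v0: "v \<noteq> 0" using w by (auto simp: v_def)
  define i where "i = v * of_real (inverse (norm v))"
  have sv: "scnj v = - v"
    using scnj_add[of w "- scnj w"] by (simp add: v_def scnj_minus)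
  have si: "scnj i = - i"
    by (simp only: i_def scnj_mult sv scnj_of_real mult_minus_left)
  have "norm i = 1" using v0 by (simp add: i_def norm_mult norm_inverse)
  then have ii: "i * i = -1"
    using mult_scnj[of i] si by (simp add: minus_equation_iff)
  have "\<exists>a b. z = of_real a + of_real b * i" for z :: 'k
  proof -
    have "scnj (z + scnj z) = z + scnj z" by (simp add: scnj_add add.commute)
    then obtain p where p: "z + scnj z = of_real p" using scnj_fixed_imp_real by blast
    have "scnj (scnj z - z) = z - scnj z"
      using scnj_add[of "scnj z" "- z"] by (simp add: scnj_minus)
    then have "scnj ((scnj z - z) * i) = (scnj z - z) * i"
      by (simp only: scnj_mult si) (simp add: algebra_simps)
    then obtain q where q: "(scnj z - z) * i = of_real q" using scnj_fixed_imp_real by blast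
    have "z - scnj z = of_real q * i"
      unfolding q[symmetric] by (simp add: mult.assoc ii)
    moreover have "2 * z = (z + scnj z) + (z - scnj z)" by simp
    ultimately have "2 * z = of_real p + of_real q * i" using p by (simp only:)
    moreover have "z = of_real (1/2) * (2 * z)" by simp
    ultimately have "z = of_real (1/2) * (of_real p + of_real q * i)" by simp
    also have "\<dots> = of_real (p/2) + of_real (q/2) * i" by (simp add: field_simps)
    finally show ?thesis by blast
  qed
  with ii show ?thesis by blast
qed


section \<open>Hilbert spaces\<close>

text \<open>
  Banach spaces whose norm is induced by a scalar-valued inner product, linear in the first and
  conjugate-linear in the second argument. The real scalar multiplication inherent in the type
  of vectors has to be the restriction of the scalar multiplication \<open>smul\<close>.
\<close>

locale hilbert_space = vector_space smul
  for smul :: "'k::real_or_complex \<Rightarrow> 'a::banach \<Rightarrow> 'a" +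
  fixes ip :: "'a \<Rightarrow> 'a \<Rightarrow> 'k"
  assumes scale_of_real: "smul (of_real r) x = r *\<^sub>R x"
    and ip_add_left: "ip (x + y) z = ip x z + ip y z"
    and ip_scale_left: "ip (smul c x) y = c * ip x y"
    and ip_commute: "ip y x = scnj (ip x y)"
    and ip_self: "ip x x = of_real ((norm x)\<^sup>2)"

lemma hilbert_space_real_inner:
  "hilbert_space scaleR (inner :: 'a::{real_inner,banach} \<Rightarrow> 'a \<Rightarrow> real)"
  by unfold_locales
    (auto simp: algebra_simps scnj_real_def inner_commute power2_norm_eq_inner)

lemma hilbert_space_complex: "hilbert_space (*) (\<lambda>z w::complex. z * cnj w)"
  by unfold_locales
    (auto simp: algebra_simps scnj_complex_def scaleR_conv_of_real complex_norm_square[symmetric] simp del: of_real_power)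

definition infinite_dimensional :: "('k::field \<Rightarrow> 'a::ab_group_add \<Rightarrow> 'a) \<Rightarrow> bool" where
  "infinite_dimensional smul \<longleftrightarrow> \<not> (\<exists>B. finite B \<and> module.span smul B = UNIV)"

text \<open>Sequences are indexed by \<open>nat\<close>, that is, starting from 0.\<close>

definition closed_span ::
    "('k::field \<Rightarrow> 'a::real_normed_vector \<Rightarrow> 'a) \<Rightarrow> (nat \<Rightarrow> 'a) \<Rightarrow> 'a set" where
  "closed_span smul x = closure (module.span smul (range x))"

definition frame :: "('a::real_normed_vector \<Rightarrow> 'a \<Rightarrow> 'k::real_normed_field) \<Rightarrow> (nat \<Rightarrow> 'a) \<Rightarrow> bool"
  where
  "frame ip x \<longleftrightarrow> (\<exists>A>0. \<exists>B>0. \<forall>u.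
     summable (\<lambda>j. (norm (ip u (x j)))\<^sup>2) \<and>
     A * (norm u)\<^sup>2 \<le> (\<Sum>j. (norm (ip u (x j)))\<^sup>2) \<and>
     (\<Sum>j. (norm (ip u (x j)))\<^sup>2) \<le> B * (norm u)\<^sup>2)"

definition orthogonal_basis ::
    "('k::field \<Rightarrow> 'a::real_normed_vector \<Rightarrow> 'a) \<Rightarrow> ('a \<Rightarrow> 'a \<Rightarrow> 'k) \<Rightarrow> (nat \<Rightarrow> 'a) \<Rightarrow> bool" where
  "orthogonal_basis smul ip e \<longleftrightarrow>
     (\<forall>j. e j \<noteq> 0) \<and> (\<forall>i j. i \<noteq> j \<longrightarrow> ip (e i) (e j) = 0) \<and> closed_span smul e = UNIV"


section \<open>Equivalence of sequences\<close>

text \<open>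
  The operators in question live on subspaces \<open>U\<close> only, so linearity, boundedness and the
  operator norm are relativised to \<open>U\<close>; values outside \<open>U\<close> are irrelevant.
\<close>

definition bounded_linear_on ::
    "('k::field \<Rightarrow> 'a::real_normed_vector \<Rightarrow> 'a) \<Rightarrow> ('k \<Rightarrow> 'b::real_normed_vector \<Rightarrow> 'b) \<Rightarrow>
     'a set \<Rightarrow> ('a \<Rightarrow> 'b) \<Rightarrow> bool" where
  "bounded_linear_on s1 s2 U T \<longleftrightarrow>
     (\<forall>u\<in>U. \<forall>v\<in>U. T (u + v) = T u + T v) \<and>
     (\<forall>c. \<forall>u\<in>U. T (s1 c u) = s2 c (T u)) \<and>
     (\<exists>K. \<forall>u\<in>U. norm (T u) \<le> norm u * K)"

definition onorm_on :: "'a::real_normed_vector set \<Rightarrow> ('a \<Rightarrow> 'b::real_normed_vector) \<Rightarrow> real" where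
  "onorm_on U T = (SUP u\<in>U. norm (T u) / norm u)"

definition isomorphism_on ::
    "('k::field \<Rightarrow> 'a::real_normed_vector \<Rightarrow> 'a) \<Rightarrow> ('k \<Rightarrow> 'b::real_normed_vector \<Rightarrow> 'b) \<Rightarrow>
     'a set \<Rightarrow> 'b set \<Rightarrow> ('a \<Rightarrow> 'b) \<Rightarrow> bool" where
  "isomorphism_on s1 s2 U V T \<longleftrightarrow>
     bij_betw T U V \<and> bounded_linear_on s1 s2 U T \<and> bounded_linear_on s2 s1 V (inv_into U T)"

definition equivalent_seq ::
    "real \<Rightarrow> ('k::field \<Rightarrow> 'a::real_normed_vector \<Rightarrow> 'a) \<Rightarrow> (nat \<Rightarrow> 'a) \<Rightarrow>
     ('k \<Rightarrow> 'b::real_normed_vector \<Rightarrow> 'b) \<Rightarrow> (nat \<Rightarrow> 'b) \<Rightarrow> bool" where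
  "equivalent_seq C s1 x s2 y \<longleftrightarrow>
     (\<exists>T. isomorphism_on s1 s2 (closed_span s1 x) (closed_span s2 y) T \<and>
          (\<forall>j. T (x j) = y j) \<and>
          onorm_on (closed_span s1 x) T *
            onorm_on (closed_span s2 y) (inv_into (closed_span s1 x) T) \<le> C)"


section \<open>The space of square-summable sequences\<close>

lemma square_summable_add:
  fixes f g :: "nat \<Rightarrow> 'k::real_normed_vector"
  assumes "summable (\<lambda>n. (norm (f n))\<^sup>2)" "summable (\<lambda>n. (norm (g n))\<^sup>2)"
  shows "summable (\<lambda>n. (norm (f n + g n))\<^sup>2)"
    and "sqrt (\<Sum>n. (norm (f n + g n))\<^sup>2)
           \<le> sqrt (\<Sum>n. (norm (f n))\<^sup>2) + sqrt (\<Sum>n. (norm (g n))\<^sup>2)"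
proof -
  let ?R = "sqrt (\<Sum>n. (norm (f n))\<^sup>2) + sqrt (\<Sum>n. (norm (g n))\<^sup>2)"
  have R0: "?R \<ge> 0" using assms by (simp add: suminf_nonneg)
  have part: "(\<Sum>n<N. (norm (f n + g n))\<^sup>2) \<le> ?R\<^sup>2" for N
  proof -
    have "sqrt (\<Sum>n<N. (norm (f n + g n))\<^sup>2) \<le> L2_set (\<lambda>n. norm (f n) + norm (g n)) {..<N}"
      unfolding L2_set_def by (intro real_sqrt_le_mono sum_mono power_mono norm_triangle_ineq) auto
    also have "\<dots> \<le> L2_set (\<lambda>n. norm (f n)) {..<N} + L2_set (\<lambda>n. norm (g n)) {..<N}"
      by (rule L2_set_triangle_ineq)
    also have "\<dots> \<le> ?R"
      unfolding L2_set_def using assms by (intro add_mono real_sqrt_le_mono sum_le_suminf) auto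
    finally show ?thesis by (rule sqrt_le_D)
  qed
  show s: "summable (\<lambda>n. (norm (f n + g n))\<^sup>2)"
    using part by (intro summableI_nonneg_bounded[where x="?R\<^sup>2"]) auto
  show "sqrt (\<Sum>n. (norm (f n + g n))\<^sup>2) \<le> ?R"
    using suminf_le_const[OF s part] R0 by (intro real_le_lsqrt) (auto intro: suminf_nonneg s)
qed

typedef (overloaded) 'k ell2 =
  "{f :: nat \<Rightarrow> 'k::real_or_complex. summable (\<lambda>n. (norm (f n))\<^sup>2)}"
  morphisms coord Abs_ell2
  by (rule exI[of _ "\<lambda>_. 0"]) simp

setup_lifting type_definition_ell2

lift_definition scale_ell2 :: "'k::real_or_complex \<Rightarrow> 'k ell2 \<Rightarrow> 'k ell2"
  is "\<lambda>c f n. c * f n"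
  by (simp add: norm_mult power_mult_distrib)

lift_definition ip_ell2 :: "'k::real_or_complex ell2 \<Rightarrow> 'k ell2 \<Rightarrow> 'k"
  is "\<lambda>f g. \<Sum>n. f n * scnj (g n)" .

instantiation ell2 :: (real_or_complex) real_vector
begin

lift_definition zero_ell2 :: "'a ell2" is "\<lambda>_. 0" by simp
lift_definition plus_ell2 :: "'a ell2 \<Rightarrow> 'a ell2 \<Rightarrow> 'a ell2" is "\<lambda>f g n. f n + g n"
  by (rule square_summable_add(1))
lift_definition uminus_ell2 :: "'a ell2 \<Rightarrow> 'a ell2" is "\<lambda>f n. - f n" by simp
lift_definition minus_ell2 :: "'a ell2 \<Rightarrow> 'a ell2 \<Rightarrow> 'a ell2" is "\<lambda>f g n. f n - g n"
proof -
  fix f g :: "nat \<Rightarrow> 'a"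
  assume "summable (\<lambda>n. (norm (f n))\<^sup>2)" "summable (\<lambda>n. (norm (g n))\<^sup>2)"
  then show "summable (\<lambda>n. (norm (f n - g n))\<^sup>2)"
    using square_summable_add(1)[of f "\<lambda>n. - g n"] by simp
qed
lift_definition scaleR_ell2 :: "real \<Rightarrow> 'a ell2 \<Rightarrow> 'a ell2" is "\<lambda>r f n. r *\<^sub>R f n"
  by (simp add: power_mult_distrib)

instance
proof
  fix x y z :: "'a ell2" and r s :: real
  show "x + y + z = x + (y + z)" by transfer (simp add: add.assoc)
  show "x + y = y + x" by transfer (simp add: add.commute)
  show "0 + x = x" by transfer simp
  show "- x + x = 0" by transfer simp
  show "x - y = x + - y" by transfer simp
  show "r *\<^sub>R (x + y) = r *\<^sub>R x + r *\<^sub>R y" by transfer (simp add: scaleR_add_right)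
  show "(r + s) *\<^sub>R x = r *\<^sub>R x + s *\<^sub>R x" by transfer (simp add: scaleR_add_left)
  show "r *\<^sub>R s *\<^sub>R x = (r * s) *\<^sub>R x" by transfer simp
  show "1 *\<^sub>R x = x" by transfer simp
qed

end

instantiation ell2 :: (real_or_complex) real_normed_vector
begin

lift_definition norm_ell2 :: "'a ell2 \<Rightarrow> real" is "\<lambda>f. sqrt (\<Sum>n. (norm (f n))\<^sup>2)" .

definition sgn_ell2 :: "'a ell2 \<Rightarrow> 'a ell2" where "sgn_ell2 x = x /\<^sub>R norm x"
definition dist_ell2 :: "'a ell2 \<Rightarrow> 'a ell2 \<Rightarrow> real" where "dist_ell2 x y = norm (x - y)"
definition uniformity_ell2 :: "('a ell2 \<times> 'a ell2) filter" where
  "uniformity_ell2 = (INF e\<in>{0 <..}. principal {(x, y). dist x y < e})"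
definition open_ell2 :: "'a ell2 set \<Rightarrow> bool" where
  "open_ell2 S = (\<forall>x\<in>S. \<forall>\<^sub>F (x', y) in uniformity. x' = x \<longrightarrow> y \<in> S)"

instance
proof
  fix x y :: "'a ell2" and r :: real
  show "norm x = 0 \<longleftrightarrow> x = 0"
    by transfer (auto simp: suminf_eq_zero_iff fun_eq_iff)
  show "norm (x + y) \<le> norm x + norm y"
    by transfer (rule square_summable_add(2))
  show "norm (r *\<^sub>R x) = \<bar>r\<bar> * norm x"
    by transfer (simp add: power_mult_distrib suminf_mult real_sqrt_mult)
qed (simp_all only: sgn_ell2_def dist_ell2_def uniformity_ell2_def open_ell2_def)

end

lemma summable_coord: "summable (\<lambda>n. (norm (coord x n))\<^sup>2)"
  using coord[of x] by simp

lemma coord_diff: "coord (x - y) n = coord x n - coord y n"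
  by transfer simp

lemma norm_coord_partial: "(\<Sum>n<N. (norm (coord x n))\<^sup>2) \<le> (norm x)\<^sup>2"
proof -
  have "(norm x)\<^sup>2 = (\<Sum>n. (norm (coord x n))\<^sup>2)"
    by (simp add: norm_ell2.rep_eq suminf_nonneg summable_coord)
  then show ?thesis using sum_le_suminf[OF summable_coord, of "{..<N}" x] by simp
qed

instance ell2 :: (real_or_complex) banach
proof
  fix X :: "nat \<Rightarrow> 'a ell2"
  assume X: "Cauchy X"
  have "Cauchy (\<lambda>m. coord (X m) n)" for n
  proof (rule metric_CauchyI)
    fix e :: real assume "e > 0"
    then obtain M where M: "\<And>m k. m \<ge> M \<Longrightarrow> k \<ge> M \<Longrightarrow> dist (X m) (X k) < e"
      using metric_CauchyD[OF X] by metis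
    have "dist (coord (X m) n) (coord (X k) n) < e" if "m \<ge> M" "k \<ge> M" for m k
    proof -
      have "(norm (coord (X m - X k) n))\<^sup>2 \<le> (\<Sum>i<Suc n. (norm (coord (X m - X k) i))\<^sup>2)"
        by (rule member_le_sum) auto
      also have "\<dots> \<le> (norm (X m - X k))\<^sup>2" by (rule norm_coord_partial)
      finally have "norm (coord (X m - X k) n) \<le> norm (X m - X k)"
        by (rule power2_le_imp_le) simp
      with M[OF that] show ?thesis by (simp add: dist_norm coord_diff)
    qed
    then show "\<exists>M. \<forall>m\<ge>M. \<forall>k\<ge>M. dist (coord (X m) n) (coord (X k) n) < e" by blast
  qed
  then have "\<exists>l. (\<lambda>m. coord (X m) n) \<longlonglongrightarrow> l" for n
    by (simp add: Cauchy_convergent_iff convergent_def)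
  then obtain f where f: "\<And>n. (\<lambda>m. coord (X m) n) \<longlonglongrightarrow> f n" by metis
  have key: "\<exists>M. \<forall>m\<ge>M. \<forall>N. (\<Sum>n<N. (norm (coord (X m) n - f n))\<^sup>2) \<le> e\<^sup>2" if "e > 0" for e
  proof -
    from that obtain M where M: "\<And>m k. m \<ge> M \<Longrightarrow> k \<ge> M \<Longrightarrow> dist (X m) (X k) < e"
      using metric_CauchyD[OF X] by metis
    have "(\<Sum>n<N. (norm (coord (X m) n - f n))\<^sup>2) \<le> e\<^sup>2" if "m \<ge> M" for m N
    proof (rule LIMSEQ_le_const2)
      show "(\<lambda>k. \<Sum>n<N. (norm (coord (X m) n - coord (X k) n))\<^sup>2)
              \<longlonglongrightarrow> (\<Sum>n<N. (norm (coord (X m) n - f n))\<^sup>2)"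
        by (intro tendsto_intros f)
      have "(\<Sum>n<N. (norm (coord (X m) n - coord (X k) n))\<^sup>2) \<le> e\<^sup>2" if "k \<ge> M" for k
      proof -
        have "(\<Sum>n<N. (norm (coord (X m) n - coord (X k) n))\<^sup>2) \<le> (norm (X m - X k))\<^sup>2"
          using norm_coord_partial[where x="X m - X k"] by (simp add: coord_diff)
        also have "\<dots> \<le> e\<^sup>2"
          using M[OF \<open>m \<ge> M\<close> that] by (intro power_mono) (auto simp: dist_norm)
        finally show ?thesis .
      qed
      then show "\<exists>K. \<forall>k\<ge>K. (\<Sum>n<N. (norm (coord (X m) n - coord (X k) n))\<^sup>2) \<le> e\<^sup>2" by blast
    qed
    then show ?thesis by blast
  qed
  have sm: "summable (\<lambda>n. (norm (coord (X m) n - f n))\<^sup>2)"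
    if "\<forall>N. (\<Sum>n<N. (norm (coord (X m) n - f n))\<^sup>2) \<le> e\<^sup>2" for m e
    using that by (intro summableI_nonneg_bounded[where x="e\<^sup>2"]) auto
  obtain M where M: "\<forall>m\<ge>M. \<forall>N. (\<Sum>n<N. (norm (coord (X m) n - f n))\<^sup>2) \<le> 1\<^sup>2"
    using key[of 1] by auto
  have "summable (\<lambda>n. (norm (f n - coord (X M) n))\<^sup>2)"
    using sm[of M 1] M by (simp add: norm_minus_commute)
  from square_summable_add(1)[OF this summable_coord[of "X M"]]
  have sf: "summable (\<lambda>n. (norm (f n))\<^sup>2)" by simp
  define L where "L = Abs_ell2 f"
  have L: "coord L = f" using sf by (simp add: L_def Abs_ell2_inverse)
  have "X \<longlonglongrightarrow> L"
  proof (rule metric_LIMSEQ_I)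
    fix e :: real assume e: "e > 0"
    then obtain M where M: "\<forall>m\<ge>M. \<forall>N. (\<Sum>n<N. (norm (coord (X m) n - f n))\<^sup>2) \<le> (e/2)\<^sup>2"
      using key[of "e/2"] by auto
    have "dist (X m) L < e" if "m \<ge> M" for m
    proof -
      have "(\<Sum>n. (norm (coord (X m) n - f n))\<^sup>2) \<le> (e/2)\<^sup>2"
        using M that sm by (intro suminf_le_const) auto
      then have "norm (X m - L) \<le> e/2"
        using real_sqrt_le_mono[of "\<Sum>n. (norm (coord (X m) n - f n))\<^sup>2" "(e/2)\<^sup>2"] e
        by (simp add: norm_ell2.rep_eq coord_diff L)
      with e show ?thesis by (simp add: dist_norm)
    qed
    then show "\<exists>M. \<forall>m\<ge>M. dist (X m) L < e" by blast
  qed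
  then show "convergent X" by (rule convergentI)
qed

lemma summable_ip_ell2: "summable (\<lambda>n. coord x n * scnj (coord y n))"
proof (rule summable_comparison_test')
  show "summable (\<lambda>n. (norm (coord x n))\<^sup>2 + (norm (coord y n))\<^sup>2)"
    by (intro summable_add summable_coord)
  fix n
  have "2 * norm (coord x n) * norm (coord y n) \<le> (norm (coord x n))\<^sup>2 + (norm (coord y n))\<^sup>2"
    by (rule sum_squares_bound)
  moreover have "0 \<le> norm (coord x n) * norm (coord y n)" by simp
  ultimately show "norm (coord x n * scnj (coord y n))
      \<le> (norm (coord x n))\<^sup>2 + (norm (coord y n))\<^sup>2"
    by (simp only: norm_mult norm_scnj)
qed

lemma bounded_linear_scnj: "bounded_linear (scnj :: 'k::real_or_complex \<Rightarrow> 'k)"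
  by (rule bounded_linear_intro[where K=1])
    (auto simp: scnj_add scnj_mult scaleR_conv_of_real)

lemma hilbert_space_ell2:
  "hilbert_space scale_ell2 (ip_ell2 :: 'k::real_or_complex ell2 \<Rightarrow> 'k ell2 \<Rightarrow> 'k)"
proof
  fix a b c :: 'k and r :: real and x y z :: "'k ell2"
  show "scale_ell2 a (x + y) = scale_ell2 a x + scale_ell2 a y"
    by transfer (simp add: distrib_left)
  show "scale_ell2 (a + b) x = scale_ell2 a x + scale_ell2 b x"
    by transfer (simp add: distrib_right)
  show "scale_ell2 a (scale_ell2 b x) = scale_ell2 (a * b) x"
    by transfer (simp add: mult.assoc)
  show "scale_ell2 1 x = x" by transfer simp
  show "scale_ell2 (of_real r) x = r *\<^sub>R x"
    by transfer (simp add: scaleR_conv_of_real)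
  show "ip_ell2 (x + y) z = ip_ell2 x z + ip_ell2 y z"
    by (simp add: ip_ell2.rep_eq plus_ell2.rep_eq distrib_right suminf_add summable_ip_ell2)
  show "ip_ell2 (scale_ell2 c x) y = c * ip_ell2 x y"
    by (simp add: ip_ell2.rep_eq scale_ell2.rep_eq mult.assoc suminf_mult summable_ip_ell2)
  show "ip_ell2 y x = scnj (ip_ell2 x y)"
    by (simp add: ip_ell2.rep_eq bounded_linear.suminf[OF bounded_linear_scnj summable_ip_ell2]
        scnj_mult mult.commute)
  have "(\<Sum>n. of_real ((norm (coord x n))\<^sup>2) :: 'k) = of_real (\<Sum>n. (norm (coord x n))\<^sup>2)"
    by (rule suminf_of_real[OF summable_coord, symmetric])
  then show "ip_ell2 x x = of_real ((norm x)\<^sup>2)"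
    by (simp add: ip_ell2.rep_eq mult_scnj norm_ell2.rep_eq suminf_nonneg summable_coord
        del: of_real_power)
qed

end

theory Submission
  imports Defs
begin

text \<open>
  Any finite set of vectors is nearly orthogonal, relative to their length, to infinitely many
  members of the frame: otherwise the upper frame bound would give
  \<open>\<Sum>\<^sub>j \<parallel>x\<^sub>j\<parallel>\<^sup>2 < \<infinity>\<close>, and a unit vector orthogonal to a long
  initial segment of the frame would violate the lower frame bound. Hence some subsequence,
  once normalised, has off-diagonal Gram entries decaying as fast as desired. The Gram matrix is
  then a small perturbation of the identity, so the synthesis operator on \<open>\<ell>\<^sub>2\<close> is an
  almost isometric isomorphism onto the closed span; the lengths of the frame vectors are
  transferred to the orthogonal basis.
\<close>

section \<open>Elementary geometry of the inner product\<close>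

context hilbert_space
begin

lemma ip_scale_right: "ip u (smul c v) = scnj c * ip u v"
  by (metis ip_commute ip_scale_left scnj_mult)

lemma ip_add_right: "ip u (v + w) = ip u v + ip u w"
  by (metis ip_add_left ip_commute scnj_add)

lemma ip_zero_left [simp]: "ip 0 v = 0"
  using ip_add_left[of 0 0 v] by simp

lemma ip_zero_right [simp]: "ip u 0 = 0"
  using ip_add_right[of u 0 0] by simp

lemma ip_diff_left: "ip (u - v) w = ip u w - ip v w"
  using ip_add_left[of "u - v" v w] by simp

lemma ip_sum_left: "ip (\<Sum>i\<in>I. f i) v = (\<Sum>i\<in>I. ip (f i) v)"
  by (induction I rule: infinite_finite_induct) (auto simp: ip_add_left)

text \<open>The vector type gives homogeneity for real scalars only; for general \<open>c\<close> it
  follows by expanding the inner product of \<open>smul c v\<close> with itself.\<close>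

lemma norm_smul: "norm (smul c v) = norm c * norm v"
proof -
  have "(of_real ((norm (smul c v))\<^sup>2) :: 'k) = (c * scnj c) * ip v v"
    by (simp only: ip_self[symmetric] ip_scale_left ip_scale_right mult_ac)
  also have "\<dots> = of_real ((norm c * norm v)\<^sup>2)"
    by (simp only: mult_scnj ip_self of_real_mult[symmetric] power_mult_distrib)
  finally have "(norm (smul c v))\<^sup>2 = (norm c * norm v)\<^sup>2"
    by (simp only: of_real_eq_iff)
  then show ?thesis
    by (simp add: power2_eq_iff_nonneg)
qed

lemma bounded_linear_smul: "bounded_linear (smul c)"
proof (rule bounded_linear_intro[where K="norm c"])
  show "smul c (r *\<^sub>R v) = r *\<^sub>R smul c v" for r v
    unfolding scale_of_real[symmetric] by (rule scale_left_commute)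
qed (auto simp: scale_right_distrib norm_smul mult.commute)

text \<open>The cross terms are \<open>ip u v\<close> and its conjugate. The two-sided form serves
  both as Pythagoras, when \<open>ip u v = 0\<close>, and as the error term of the Gram
  estimate.\<close>

lemma norm_add_square_bound:
  "\<bar>(norm (u + v))\<^sup>2 - ((norm u)\<^sup>2 + (norm v)\<^sup>2)\<bar> \<le> 2 * norm (ip u v)"
proof -
  have "(of_real ((norm (u + v))\<^sup>2 - ((norm u)\<^sup>2 + (norm v)\<^sup>2)) :: 'k)
      = ip (u + v) (u + v) - (ip u u + ip v v)"
    by (simp only: ip_self of_real_diff of_real_add)
  also have "\<dots> = ip u v + scnj (ip u v)"
    by (simp only: ip_add_left ip_add_right ip_commute[of v u]) simp
  finally have "\<bar>(norm (u + v))\<^sup>2 - ((norm u)\<^sup>2 + (norm v)\<^sup>2)\<bar>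
      = norm (ip u v + scnj (ip u v))"
    by (metis norm_of_real)
  also have "\<dots> \<le> 2 * norm (ip u v)"
    using norm_triangle_ineq[of "ip u v" "scnj (ip u v)"] by simp
  finally show ?thesis .
qed

lemma Cauchy_Schwarz: "norm (ip u v) \<le> norm u * norm v"
proof (cases "v = 0")
  case True
  then show ?thesis by simp
next
  case False
  \<comment> \<open>\<open>smul d v\<close> is the projection of \<open>u\<close> onto the line
    through \<open>v\<close>; by Pythagoras it is no longer than \<open>u\<close>.\<close>
  define d where "d = ip u v / of_real ((norm v)\<^sup>2)"
  define w where "w = u - smul d v"
  have "ip w v = 0"
    using False by (simp add: w_def ip_diff_left ip_scale_left ip_self d_def)
  then have "ip w (smul d v) = 0" by (simp add: ip_scale_right)
  moreover have "w + smul d v = u" by (simp add: w_def)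
  ultimately have "(norm u)\<^sup>2 = (norm w)\<^sup>2 + (norm (smul d v))\<^sup>2"
    using norm_add_square_bound[of w "smul d v"] by simp
  then have "(norm (smul d v))\<^sup>2 \<le> (norm u)\<^sup>2"
    using zero_le_power2[of "norm w"] by linarith
  then have "norm (smul d v) \<le> norm u"
    by (rule power2_le_imp_le) simp
  moreover have "norm d = norm (ip u v) / (norm v)\<^sup>2"
    unfolding d_def norm_divide norm_of_real by simp
  ultimately have "norm (ip u v) / (norm v)\<^sup>2 * norm v \<le> norm u"
    by (simp only: norm_smul)
  moreover have "norm (ip u v) / (norm v)\<^sup>2 * norm v = norm (ip u v) / norm v"
    by (simp add: power2_eq_square)
  ultimately show ?thesis
    using False by (simp only: pos_divide_le_eq zero_less_norm_iff not_False_eq_True simp_thms)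
qed

lemma sgn_eq_smul: "sgn v = smul (of_real (inverse (norm v))) v"
  by (simp only: scale_of_real sgn_div_norm)

lemma norm_ip_sgn_right: "norm (ip u (sgn v)) = norm (ip u v) / norm v"
  by (simp only: sgn_eq_smul ip_scale_right scnj_of_real norm_mult norm_of_real)
     (simp add: divide_inverse)

section \<open>Vectors orthogonal to a finite set\<close>

text \<open>The orthogonal complement of a finite set has finite codimension. A new \<open>z\<close>
  imposes one further linear condition on the vectors orthogonal to \<open>F\<close>: either it
  holds there already, or a single \<open>w\<close> violating it suffices to correct every
  \<open>v\<close>.\<close>

lemma finite_span_plus_orthogonal:
  assumes "finite F"
  shows "\<exists>B. finite B \<and> (\<forall>v. \<exists>b\<in>span B. \<forall>z\<in>F. ip (v - b) z = 0)"
  using assms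
proof (induction F)
  case empty
  show ?case using span_zero by blast
next
  case (insert z F)
  then obtain B where B: "finite B" "\<And>v. \<exists>b\<in>span B. \<forall>z\<in>F. ip (v - b) z = 0"
    by blast
  show ?case
  proof (cases "\<forall>w. (\<forall>y\<in>F. ip w y = 0) \<longrightarrow> ip w z = 0")
    case True
    then have "\<exists>b\<in>span B. \<forall>y\<in>insert z F. ip (v - b) y = 0" for v
      using B(2)[of v] by blast
    with B(1) show ?thesis by blast
  next
    case False
    then obtain w where w: "\<forall>y\<in>F. ip w y = 0" "ip w z \<noteq> 0" by blast
    have "\<exists>b\<in>span (insert w B). \<forall>y\<in>insert z F. ip (v - b) y = 0" for v
    proof -
      obtain b where b: "b \<in> span B" "\<forall>y\<in>F. ip (v - b) y = 0" using B by blast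
      \<comment> \<open>This coefficient cancels the product with \<open>z\<close>; products with
        members of \<open>F\<close> do not change, since \<open>w\<close> is orthogonal to
        them.\<close>
      define c where "c = ip (v - b) z / ip w z"
      have "b + smul c w \<in> span (insert w B)"
        using b(1) span_mono[of B "insert w B"]
        by (intro span_add span_scale span_base[of w]) auto
      moreover have "ip (v - (b + smul c w)) y = ip (v - b) y - c * ip w y" for y
        by (simp add: diff_add_eq_diff_diff_swap ip_diff_left ip_scale_left)
      ultimately show ?thesis
        using b w by (intro bexI[of _ "b + smul c w"]) (auto simp: c_def)
    qed
    with B(1) show ?thesis by (intro exI[of _ "insert w B"]) auto
  qed
qed

text \<open>A finite span misses some \<open>v\<close>, so the part of \<open>v\<close> orthogonal
  to \<open>F\<close> is nonzero and can be normalised.\<close>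

lemma exists_unit_orthogonal:
  assumes "infinite_dimensional smul" "finite F"
  obtains u where "norm u = 1" "\<And>z. z \<in> F \<Longrightarrow> ip u z = 0"
proof -
  obtain B where B: "finite B" "\<And>v. \<exists>b\<in>span B. \<forall>z\<in>F. ip (v - b) z = 0"
    using finite_span_plus_orthogonal[OF assms(2)] by blast
  from assms(1) B(1) obtain v where v: "v \<notin> span B"
    by (auto simp: infinite_dimensional_def)
  obtain b where b: "b \<in> span B" "\<forall>z\<in>F. ip (v - b) z = 0" using B by blast
  have "v - b \<noteq> 0" using b v by auto
  then have "norm (sgn (v - b)) = 1" by (simp add: norm_sgn)
  moreover have "ip (sgn (v - b)) z = 0" if "z \<in> F" for z
    using b that by (simp add: sgn_eq_smul ip_scale_left)
  ultimately show ?thesis by (rule that)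
qed

section \<open>Selecting an almost orthogonal subsequence of the frame\<close>

lemma frame_norm_not_summable:
  assumes "infinite_dimensional smul" "frame ip x"
  shows "\<not> summable (\<lambda>j. (norm (x j))\<^sup>2)"
proof
  assume s: "summable (\<lambda>j. (norm (x j))\<^sup>2)"
  obtain A where A: "A > 0" "\<And>u. summable (\<lambda>j. (norm (ip u (x j)))\<^sup>2)"
    "\<And>u. A * (norm u)\<^sup>2 \<le> (\<Sum>j. (norm (ip u (x j)))\<^sup>2)"
    using assms(2) by (auto simp: frame_def)
  \<comment> \<open>A unit vector orthogonal to the first \<open>N\<close> frame vectors sees only
    this tail, which by Cauchy-Schwarz is too small for the lower bound \<open>A\<close>.\<close>
  obtain N where N: "norm (\<Sum>i. (norm (x (i + N)))\<^sup>2) < A"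
    using suminf_exist_split[OF A(1) s] by auto
  obtain u where u: "norm u = 1" "\<And>z. z \<in> x ` {..<N} \<Longrightarrow> ip u z = 0"
    by (rule exists_unit_orthogonal[OF assms(1), of "x ` {..<N}"]) auto
  have "A \<le> (\<Sum>j. (norm (ip u (x j)))\<^sup>2)"
    using A(3)[of u] u by simp
  also have "\<dots> = (\<Sum>j. (norm (ip u (x (j + N))))\<^sup>2)"
    using suminf_split_initial_segment[OF A(2), of u N] u(2) by simp
  also have "\<dots> \<le> (\<Sum>j. (norm (x (j + N)))\<^sup>2)"
  proof (rule suminf_le)
    show "(norm (ip u (x (j + N))))\<^sup>2 \<le> (norm (x (j + N)))\<^sup>2" for j
      using Cauchy_Schwarz[of u "x (j + N)"] u(1) by (intro power_mono) auto
    show "summable (\<lambda>j. (norm (ip u (x (j + N))))\<^sup>2)"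
      using A(2)[of u] by (subst summable_iff_shift)
    show "summable (\<lambda>j. (norm (x (j + N)))\<^sup>2)"
      using s by (subst summable_iff_shift)
  qed
  also have "\<dots> < A" using N by simp
  finally show False by simp
qed

text \<open>If this failed from \<open>N\<close> on, every later
  \<parallel>\<open>x j\<close>\<parallel> would be at most 1/\<delta> times some
  |\<open>ip v (x j)\<close>| with \<open>v\<close> in \<open>F\<close>. The squared lengths would
  then be dominated by finitely many series that the frame property makes summable.\<close>

lemma frame_almost_orthogonal:
  assumes "infinite_dimensional smul" "frame ip x" "finite F" "\<delta> > 0"
  shows "\<exists>j\<ge>N. x j \<noteq> 0 \<and> (\<forall>v\<in>F. norm (ip v (sgn (x j))) \<le> \<delta>)"
proof (rule ccontr)
  assume contr: "\<not> ?thesis"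
  have bound: "(norm (x j))\<^sup>2 \<le> (\<Sum>v\<in>F. (norm (ip v (x j)))\<^sup>2) / \<delta>\<^sup>2" if "j \<ge> N" for j
  proof (cases "x j = 0")
    case False
    with contr that obtain v where v: "v \<in> F" "norm (ip v (sgn (x j))) > \<delta>"
      by (meson not_le)
    have "\<delta> * norm (x j) \<le> norm (ip v (x j))"
      using v(2) False by (simp add: norm_ip_sgn_right field_simps)
    then have "\<delta>\<^sup>2 * (norm (x j))\<^sup>2 \<le> (norm (ip v (x j)))\<^sup>2"
      using assms(4) power_mono[of "\<delta> * norm (x j)" _ 2] by (simp add: power_mult_distrib)
    also have "\<dots> \<le> (\<Sum>v\<in>F. (norm (ip v (x j)))\<^sup>2)"
      using v(1) assms(3) by (intro member_le_sum) auto
    finally show ?thesis using assms(4) by (simp add: field_simps)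
  qed (simp add: sum_nonneg)
  have "summable (\<lambda>j. (norm (x j))\<^sup>2)"
  proof (rule summable_comparison_test')
    show "summable (\<lambda>j. (\<Sum>v\<in>F. (norm (ip v (x j)))\<^sup>2) / \<delta>\<^sup>2)"
      using assms(2) by (intro summable_divide summable_sum) (auto simp: frame_def)
  qed (use bound in auto)
  with frame_norm_not_summable[OF assms(1,2)] show False by contradiction
qed

lemma frame_almost_orthogonal_subsequence:
  assumes "infinite_dimensional smul" "frame ip x" "\<And>n. \<delta> n > 0"
  obtains r :: "nat \<Rightarrow> nat" where "strict_mono r" "\<And>n. x (r n) \<noteq> 0"
    "\<And>i n. i < n \<Longrightarrow> norm (ip (sgn (x (r i))) (sgn (x (r n)))) \<le> \<delta> n"
proof -
  \<comment> \<open>Smallness is demanded against all \<open>x i\<close> with \<open>i < N\<close>,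
    not only the selected ones, so the recursion for \<open>r\<close> has to remember just the last
    index.\<close>
  have "\<exists>j\<ge>N. x j \<noteq> 0 \<and> (\<forall>i<N. norm (ip (sgn (x i)) (sgn (x j))) \<le> \<delta> n)" for n N
    using frame_almost_orthogonal[OF assms(1,2) _ assms(3), of "(\<lambda>i. sgn (x i)) ` {..<N}" N n]
    by auto
  then have "\<exists>g. \<forall>n N. g n N \<ge> N \<and> x (g n N) \<noteq> 0 \<and>
      (\<forall>i<N. norm (ip (sgn (x i)) (sgn (x (g n N)))) \<le> \<delta> n)"
    by (intro choice allI)
  then obtain g where g: "\<And>n N. g n N \<ge> N" "\<And>n N. x (g n N) \<noteq> 0"
    "\<And>n N i. i < N \<Longrightarrow> norm (ip (sgn (x i)) (sgn (x (g n N)))) \<le> \<delta> n"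
    by blast
  define r where "r = rec_nat (g 0 0) (\<lambda>n k. g (Suc n) (Suc k))"
  have r: "r 0 = g 0 0" "\<And>n. r (Suc n) = g (Suc n) (Suc (r n))"
    by (simp_all add: r_def)
  have mono: "strict_mono r"
    unfolding strict_mono_Suc_iff r using g(1) Suc_le_lessD by blast
  show ?thesis
  proof
    show "strict_mono r" by (rule mono)
    show "x (r n) \<noteq> 0" for n by (cases n) (auto simp: r g)
    show "norm (ip (sgn (x (r i))) (sgn (x (r n)))) \<le> \<delta> n" if "i < n" for i n
    proof -
      obtain m where m: "n = Suc m" using \<open>i < n\<close> by (cases n) auto
      have "r i < Suc (r m)"
        using \<open>i < n\<close> mono by (simp add: m less_Suc_eq_le strict_mono_less_eq)
      then show ?thesis by (simp add: m r(2) g(3))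
    qed
  qed
qed

section \<open>The Gram estimate for finite sums\<close>

text \<open>Adding the \<open>n\<close>-th term creates \<open>n\<close> cross products. In the
  bound \<open>small\<close>, the factor \<open>Suc n\<close> pays for their number, the 2 for their
  doubling, and the power of two makes the errors of successive terms a geometric series.\<close>

lemma almost_orthonormal_sum:
  assumes norm1: "\<And>n. norm (y n) = 1" and "\<eta> \<ge> 0"
    and small: "\<And>i n. i < n \<Longrightarrow> norm (ip (y i) (y n)) \<le> \<eta> / (2 * Suc n * 2 ^ Suc n)"
  shows "\<bar>(norm (\<Sum>i<n. smul (a i) (y i)))\<^sup>2 - (\<Sum>i<n. (norm (a i))\<^sup>2)\<bar>
    \<le> \<eta> * (\<Sum>i<n. (norm (a i))\<^sup>2)"
proof -
  define M where "M = (\<Sum>i<n. (norm (a i))\<^sup>2)"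
  have M0: "M \<ge> 0" by (simp add: M_def sum_nonneg)
  have aM: "norm (a i) \<le> sqrt M" if "i < n" for i
    unfolding M_def using that by (intro real_le_rsqrt member_le_sum) auto
  \<comment> \<open>\<open>M\<close> is the full coefficient sum and stays fixed during the
    induction; \<open>1 - 1 / 2 ^ k\<close> is the sum of the first \<open>k\<close> terms 1/2, 1/4,
    and so on.\<close>
  have "\<bar>(norm (\<Sum>i<k. smul (a i) (y i)))\<^sup>2 - (\<Sum>i<k. (norm (a i))\<^sup>2)\<bar>
      \<le> \<eta> * M * (1 - 1 / 2 ^ k)" if "k \<le> n" for k
    using that
  proof (induction k)
    case (Suc k)
    let ?s = "\<Sum>i<k. smul (a i) (y i)"
    have "norm (ip ?s (smul (a k) (y k)))
        \<le> (\<Sum>i<k. norm (a i) * norm (a k) * norm (ip (y i) (y k)))"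
      unfolding ip_sum_left
      by (rule order_trans[OF norm_sum])
         (simp add: ip_scale_left ip_scale_right norm_mult mult_ac)
    also have "\<dots> \<le> (\<Sum>i<k. sqrt M * sqrt M * (\<eta> / (2 * Suc k * 2 ^ Suc k)))"
      using Suc.prems by (intro sum_mono mult_mono aM small mult_nonneg_nonneg) (auto simp: M0)
    also have "\<dots> = \<eta> * M / (2 * 2 ^ Suc k) * (k / Suc k)"
      using M0 by (simp add: field_simps)
    also have "\<dots> \<le> \<eta> * M / (2 * 2 ^ Suc k)"
      using M0 \<open>\<eta> \<ge> 0\<close> by (intro mult_left_le) (auto simp: field_simps)
    finally have "2 * norm (ip ?s (smul (a k) (y k))) \<le> \<eta> * M / 2 ^ Suc k"
      by simp
    with norm_add_square_bound[of ?s "smul (a k) (y k)"]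
    have "\<bar>(norm (\<Sum>i<Suc k. smul (a i) (y i)))\<^sup>2 - ((norm ?s)\<^sup>2 + (norm (a k))\<^sup>2)\<bar>
        \<le> \<eta> * M / 2 ^ Suc k"
      by (simp add: norm_smul norm1)
    with Suc have "\<bar>(norm (\<Sum>i<Suc k. smul (a i) (y i)))\<^sup>2 - (\<Sum>i<Suc k. (norm (a i))\<^sup>2)\<bar>
        \<le> \<eta> * M * (1 - 1 / 2 ^ k) + \<eta> * M / 2 ^ Suc k"
      by simp
    also have "\<dots> = \<eta> * M * (1 - 1 / 2 ^ Suc k)"
      by (simp add: field_simps)
    finally show ?case .
  qed simp
  from this[of n] show ?thesis
    using mult_left_mono[of "1 - 1 / 2 ^ n" 1 "\<eta> * M"] M0 \<open>\<eta> \<ge> 0\<close>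
    by (simp add: M_def)
qed

end

section \<open>The coordinate vectors of the sequence space\<close>

lemma norm_ell2_square: "(\<lambda>n. (norm (coord f n))\<^sup>2) sums (norm f)\<^sup>2"
  using summable_sums[OF summable_coord[of f]]
  by (simp add: norm_ell2.rep_eq suminf_nonneg summable_coord)

lemma coord_sum: "coord (\<Sum>i\<in>I. f i) n = (\<Sum>i\<in>I. coord (f i) n)"
  by (induction I rule: infinite_finite_induct) (auto simp: zero_ell2.rep_eq plus_ell2.rep_eq)

lift_definition unit_ell2 :: "nat \<Rightarrow> 'k::real_or_complex ell2" is "\<lambda>k n. if n = k then 1 else 0"
  by (rule summable_finite[of "{k}" for k]) auto

lemma unit_ell2_sums:
  "(\<lambda>N. \<Sum>k<N. scale_ell2 (coord f k) (unit_ell2 k)) \<longlonglongrightarrow> (f :: 'k::real_or_complex ell2)"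
proof -
  let ?p = "\<lambda>N. \<Sum>k<N. scale_ell2 (coord f k) (unit_ell2 k)"
  have p: "coord (?p N) n = (if n < N then coord f n else 0)" for N n
    by (simp add: coord_sum scale_ell2.rep_eq unit_ell2.rep_eq if_distrib sum.delta cong: if_cong)
  \<comment> \<open>The difference has the coordinates of \<open>f\<close> from \<open>N\<close> on
    and zeros before, so its squared norm is a tail of a convergent series.\<close>
  have "(norm (f - ?p N))\<^sup>2 = (norm f)\<^sup>2 - (\<Sum>n<N. (norm (coord f n))\<^sup>2)" for N
  proof (rule sums_unique2[OF norm_ell2_square])
    have "(\<lambda>n. (norm (coord f n))\<^sup>2 - (if n \<in> {..<N} then (norm (coord f n))\<^sup>2 else 0))
        sums ((norm f)\<^sup>2 - (\<Sum>n<N. (norm (coord f n))\<^sup>2))"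
      by (intro sums_diff norm_ell2_square sums_If_finite_set) auto
    moreover have "(\<lambda>n. (norm (coord f n))\<^sup>2 - (if n \<in> {..<N} then (norm (coord f n))\<^sup>2 else 0))
        = (\<lambda>n. (norm (coord (f - ?p N) n))\<^sup>2)"
      by (auto simp: coord_diff p)
    ultimately show "(\<lambda>n. (norm (coord (f - ?p N) n))\<^sup>2)
        sums ((norm f)\<^sup>2 - (\<Sum>n<N. (norm (coord f n))\<^sup>2))"
      by simp
  qed
  moreover have "(\<lambda>N. (norm f)\<^sup>2 - (\<Sum>n<N. (norm (coord f n))\<^sup>2)) \<longlonglongrightarrow> (norm f)\<^sup>2 - (norm f)\<^sup>2"
    using norm_ell2_square[of f] unfolding sums_def by (intro tendsto_intros)
  ultimately have "(\<lambda>N. sqrt ((norm (f - ?p N))\<^sup>2)) \<longlonglongrightarrow> sqrt 0"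
    by (intro tendsto_real_sqrt) simp
  then have "(\<lambda>N. norm (?p N - f)) \<longlonglongrightarrow> 0"
    by (simp add: norm_minus_commute)
  then show ?thesis
    using LIM_zero_cancel tendsto_norm_zero_iff by blast
qed

text \<open>The free factors \<open>c k\<close> later carry the lengths of the frame vectors.
  Dividing by them puts every truncation of \<open>f\<close> into the span, and the truncations
  converge to \<open>f\<close>.\<close>

lemma orthogonal_basis_scaled_unit:
  fixes c :: "nat \<Rightarrow> 'k::real_or_complex"
  assumes "\<And>k. c k \<noteq> 0"
  shows "orthogonal_basis scale_ell2 ip_ell2 (\<lambda>k. scale_ell2 (c k) (unit_ell2 k))"
    (is "orthogonal_basis _ _ ?e")
proof -
  interpret E: hilbert_space scale_ell2 "ip_ell2 :: 'k ell2 \<Rightarrow> _" by (rule hilbert_space_ell2)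
  have "coord (unit_ell2 k :: 'k ell2) k = 1" for k
    by (simp add: unit_ell2.rep_eq)
  then have nz: "unit_ell2 k \<noteq> (0 :: 'k ell2)" for k
    by (metis zero_ell2.rep_eq zero_neq_one)
  have orth: "ip_ell2 (unit_ell2 i) (unit_ell2 j) = (0::'k)" if "i \<noteq> j" for i j
  proof -
    have "(\<lambda>n. coord (unit_ell2 i) n * scnj (coord (unit_ell2 j) n)) = (\<lambda>_. 0 :: 'k)"
      using that by (auto simp: unit_ell2.rep_eq)
    then show ?thesis by (simp only: ip_ell2.rep_eq suminf_zero)
  qed
  have "f \<in> closure (E.span (range ?e))" for f
  proof (rule closed_sequentially[OF closed_closure _ unit_ell2_sums])
    fix N
    have "scale_ell2 (coord f k) (unit_ell2 k) \<in> E.span (range ?e)" for k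
    proof -
      have "scale_ell2 (coord f k / c k) (?e k) \<in> E.span (range ?e)"
        by (intro E.span_scale E.span_base) auto
      then show ?thesis using assms by simp
    qed
    then have "(\<Sum>k<N. scale_ell2 (coord f k) (unit_ell2 k)) \<in> E.span (range ?e)"
      by (intro E.span_sum)
    then show "(\<Sum>k<N. scale_ell2 (coord f k) (unit_ell2 k)) \<in> closure (E.span (range ?e))"
      using closure_subset by blast
  qed
  then show ?thesis
    using assms nz orth
    by (auto simp: orthogonal_basis_def closed_span_def E.ip_scale_left E.ip_scale_right)
qed

section \<open>Equivalence of sequences from a two-sided norm estimate\<close>

text \<open>Since division by 0 yields 0, the zero vector contributes the quotient 0; this makes the
  supremum nonnegative, as multiplying two such bounds requires.\<close>

lemma onorm_on_bounds:
  assumes "0 \<in> U" "K \<ge> 0" "\<And>u. u \<in> U \<Longrightarrow> norm (T u) \<le> K * norm u"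
  shows "0 \<le> onorm_on U T" "onorm_on U T \<le> K"
proof -
  have b: "norm (T u) / norm u \<le> K" if "u \<in> U" for u
    using assms(3)[OF that] assms(2) by (cases "u = 0") (auto simp: field_simps)
  show "onorm_on U T \<le> K"
    unfolding onorm_on_def using assms(1) b by (intro cSUP_least) auto
  have "norm (T 0) / norm (0::'a) \<le> onorm_on U T"
    unfolding onorm_on_def using b assms(1) by (intro cSUP_upper) (auto intro!: bdd_aboveI2)
  then show "0 \<le> onorm_on U T" by simp
qed

text \<open>The natural operator \<open>S\<close> runs from the basis to \<open>x\<close>, against
  the direction in \<open>equivalent_seq\<close>, so the witness is its inverse. The estimates bound
  the norm of \<open>inv S\<close> by \<open>1 / a\<close> and that of \<open>S\<close> by
  \<open>b\<close>.\<close>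

lemma equivalent_seq_of_embedding:
  fixes S :: "'b::banach \<Rightarrow> 'a::banach" and s1 :: "'k::real_or_complex \<Rightarrow> 'a \<Rightarrow> 'a"
  assumes h1: "hilbert_space s1 ip1" and h2: "hilbert_space s2 ip2"
    and add: "\<And>f g. S (f + g) = S f + S g" and scale: "\<And>c f. S (s2 c f) = s1 c (S f)"
    and "a > 0" "b \<ge> 0"
    and lower: "\<And>f. a * norm f \<le> norm (S f)" and upper: "\<And>f. norm (S f) \<le> b * norm f"
    and e: "closed_span s2 e = UNIV" and Se: "\<And>j. S (e j) = x j"
  shows "equivalent_seq (b / a) s1 x s2 e"
proof -
  interpret H1: hilbert_space s1 ip1 by (rule h1)
  interpret H2: hilbert_space s2 ip2 by (rule h2)
  interpret S: module_hom s2 s1 S by unfold_locales (auto simp: add scale)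
  have bl: "bounded_linear S"
  proof (rule bounded_linear_intro[where K=b])
    show "S (r *\<^sub>R f) = r *\<^sub>R S f" for r f
      by (metis H1.scale_of_real H2.scale_of_real scale)
  qed (auto simp: add upper mult.commute)
  have inj: "inj S"
  proof (rule injI)
    fix f g assume "S f = S g"
    then show "f = g"
      using lower[of "f - g"] \<open>a > 0\<close> by (simp add: S.diff mult_le_0_iff)
  qed
  \<comment> \<open>The lower bound transfers completeness of the domain to the image. Thus
    \<open>range S\<close> is closed and, by continuity of \<open>S\<close>, is exactly the closed
    span of \<open>x\<close>.\<close>
  have "complete (range S)"
    by (rule complete_isometric_image[OF \<open>a > 0\<close> _ bl])
       (auto simp: lower complete_UNIV)
  then have closed: "closed (range S)" by (rule complete_imp_closed)
  have span: "S ` H2.span (range e) = H1.span (range x)"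
    by (simp add: S.span_image[symmetric] image_image Se)
  have range: "closed_span s1 x = range S"
  proof
    show "closed_span s1 x \<subseteq> range S"
      unfolding closed_span_def span[symmetric] using closed by (intro closure_minimal) auto
    show "range S \<subseteq> closed_span s1 x"
      using closure_bounded_linear_image_subset[OF bl, of "H2.span (range e)"] e
      by (simp add: closed_span_def span)
  qed
  let ?T = "inv S"
  have T: "?T (S f) = f" for f by (rule inv_f_f[OF inj])
  have bij: "bij_betw ?T (range S) UNIV"
    using inj by (simp add: inj_imp_bij_betw_inv)
  \<comment> \<open>The definition measures the inverse as \<open>inv_into\<close> of the witness;
    inverting twice gives back \<open>S\<close>.\<close>
  have inv: "inv_into (range S) ?T f = S f" for f
    by (rule inv_into_f_eq) (use bij T in \<open>auto simp: bij_betw_def\<close>)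
  have Tbound: "norm (?T u) \<le> 1 / a * norm u" if "u \<in> range S" for u
    using that lower \<open>a > 0\<close> by (auto simp: T field_simps)
  have linT: "bounded_linear_on s1 s2 (range S) ?T"
    unfolding bounded_linear_on_def
  proof (intro conjI ballI allI exI)
    fix u v assume "u \<in> range S" "v \<in> range S"
    then show "?T (u + v) = ?T u + ?T v" by (metis T add rangeE)
  next
    fix c u assume "u \<in> range S"
    then show "?T (s1 c u) = s2 c (?T u)" by (metis T scale rangeE)
  next
    fix u assume "u \<in> range S"
    then show "norm (?T u) \<le> norm u * (1 / a)" using Tbound by (simp add: mult.commute)
  qed
  have linS: "bounded_linear_on s2 s1 UNIV (inv_into (range S) ?T)"
    unfolding bounded_linear_on_def inv
    using upper by (auto simp: add scale intro!: exI[of _ b] simp: mult.commute)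
  have 0: "0 \<in> range S" by (metis S.zero rangeI)
  have "onorm_on (range S) ?T * onorm_on UNIV (inv_into (range S) ?T) \<le> (1 / a) * b"
    using onorm_on_bounds[OF 0 _ Tbound] \<open>a > 0\<close> \<open>b \<ge> 0\<close> upper
      onorm_on_bounds[of UNIV b "inv_into (range S) ?T"]
    by (intro mult_mono) (auto simp: inv)
  then have "onorm_on (range S) ?T * onorm_on UNIV (inv_into (range S) ?T) \<le> b / a"
    by simp
  moreover have "?T (x j) = e j" for j using T[of "e j"] by (simp only: Se)
  ultimately show ?thesis
    unfolding equivalent_seq_def range e isomorphism_on_def
    using bij linT linS by blast
qed

section \<open>The synthesis operator of an almost orthonormal sequence\<close>

context hilbert_space
begin

text \<open>The operator sends \<open>f\<close> to the series of its coordinates times the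
  \<open>y i\<close>. Both norm estimates pass to the limit from finite sums, and square roots
  appear because the Gram estimate concerns squared norms.\<close>

lemma almost_orthonormal_equivalent:
  assumes norm1: "\<And>n. norm (y n) = 1" and \<eta>: "0 \<le> \<eta>" "\<eta> < 1"
    and small: "\<And>i n. i < n \<Longrightarrow> norm (ip (y i) (y n)) \<le> \<eta> / (2 * Suc n * 2 ^ Suc n)"
    and c: "\<And>n. c n \<noteq> 0"
  shows "equivalent_seq (sqrt (1 + \<eta>) / sqrt (1 - \<eta>)) smul (\<lambda>n. smul (c n) (y n))
    scale_ell2 (\<lambda>n. scale_ell2 (c n) (unit_ell2 n))"
proof -
  interpret E: hilbert_space scale_ell2 "ip_ell2 :: 'k ell2 \<Rightarrow> _" by (rule hilbert_space_ell2)
  note bound = almost_orthonormal_sum[OF norm1 \<eta>(1) small]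
  have upper: "(norm (\<Sum>i<n. smul (a i) (y i)))\<^sup>2 \<le> (1 + \<eta>) * (\<Sum>i<n. (norm (a i))\<^sup>2)"
    and lower: "(1 - \<eta>) * (\<Sum>i<n. (norm (a i))\<^sup>2) \<le> (norm (\<Sum>i<n. smul (a i) (y i)))\<^sup>2" for n a
    using bound[of a n] by (auto simp: abs_le_iff algebra_simps)
  have sm: "summable (\<lambda>i. smul (coord f i) (y i))" for f
    unfolding summable_Cauchy
  proof (intro allI impI)
    fix d :: real assume d: "d > 0"
    then have "d\<^sup>2 / 2 > 0" by simp
    then obtain N where N: "\<And>m n. m \<ge> N \<Longrightarrow> norm (\<Sum>i=m..<n. (norm (coord f i))\<^sup>2) < d\<^sup>2 / 2"
      using summable_coord[of f] unfolding summable_Cauchy by blast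
    have "norm (\<Sum>i=m..<n. smul (coord f i) (y i)) < d" if "m \<ge> N" for m n
    proof -
      \<comment> \<open>Zeroing the first \<open>m\<close> coefficients turns a block of the series
        into an initial sum, to which \<open>upper\<close> applies.\<close>
      define a where "a i = (if m \<le> i then coord f i else 0)" for i
      have "(\<Sum>i=m..<n. smul (coord f i) (y i)) = (\<Sum>i<n. smul (a i) (y i))"
        by (rule sum.mono_neutral_cong_left) (auto simp: a_def)
      moreover have "(\<Sum>i=m..<n. (norm (coord f i))\<^sup>2) = (\<Sum>i<n. (norm (a i))\<^sup>2)"
        by (rule sum.mono_neutral_cong_left) (auto simp: a_def)
      ultimately have "(norm (\<Sum>i=m..<n. smul (coord f i) (y i)))\<^sup>2
          \<le> (1 + \<eta>) * (\<Sum>i=m..<n. (norm (coord f i))\<^sup>2)"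
        using upper[where n=n and a=a] by simp
      also have "\<dots> \<le> 2 * (\<Sum>i=m..<n. (norm (coord f i))\<^sup>2)"
        using \<eta> by (intro mult_right_mono sum_nonneg) auto
      also have "\<dots> < d\<^sup>2" using N[OF that, of n] by simp
      finally show ?thesis by (rule power2_less_imp_less) (use d in simp)
    qed
    then show "\<exists>N. \<forall>m\<ge>N. \<forall>n. norm (\<Sum>i=m..<n. smul (coord f i) (y i)) < d" by blast
  qed
  define S where "S f = (\<Sum>i. smul (coord f i) (y i))" for f
  have lim: "(\<lambda>n. (norm (\<Sum>i<n. smul (coord f i) (y i)))\<^sup>2) \<longlonglongrightarrow> (norm (S f))\<^sup>2" for f
    unfolding S_def using summable_LIMSEQ[OF sm] by (intro tendsto_intros)
  have lim': "(\<lambda>n. K * (\<Sum>i<n. (norm (coord f i))\<^sup>2)) \<longlonglongrightarrow> K * (norm f)\<^sup>2"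
    for K and f :: "'k ell2"
    using norm_ell2_square[of f] unfolding sums_def by (intro tendsto_intros)
  have add: "S (f + g) = S f + S g" for f g
    by (simp add: S_def plus_ell2.rep_eq scale_left_distrib suminf_add sm)
  have scale: "S (scale_ell2 d f) = smul d (S f)" for d f
    using bounded_linear.suminf[OF bounded_linear_smul sm]
    by (simp add: S_def scale_ell2.rep_eq)
  have unit: "S (unit_ell2 n) = y n" for n
  proof -
    have "(\<lambda>i. smul (coord (unit_ell2 n) i) (y i)) = (\<lambda>i. if i = n then y i else 0)"
      by (auto simp: unit_ell2.rep_eq)
    then show ?thesis
      unfolding S_def using sums_unique[OF sums_single[of n y]] by simp
  qed
  have lower': "sqrt (1 - \<eta>) * norm f \<le> norm (S f)" for f
  proof -
    have "(1 - \<eta>) * (norm f)\<^sup>2 \<le> (norm (S f))\<^sup>2"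
      by (rule LIMSEQ_le[OF lim' lim]) (use lower in blast)
    then have "sqrt ((1 - \<eta>) * (norm f)\<^sup>2) \<le> sqrt ((norm (S f))\<^sup>2)" by (rule real_sqrt_le_mono)
    then show ?thesis by (simp add: real_sqrt_mult)
  qed
  have upper': "norm (S f) \<le> sqrt (1 + \<eta>) * norm f" for f
  proof -
    have "(norm (S f))\<^sup>2 \<le> (1 + \<eta>) * (norm f)\<^sup>2"
      by (rule LIMSEQ_le[OF lim lim']) (use upper in blast)
    then have "sqrt ((norm (S f))\<^sup>2) \<le> sqrt ((1 + \<eta>) * (norm f)\<^sup>2)" by (rule real_sqrt_le_mono)
    then show ?thesis by (simp add: real_sqrt_mult)
  qed
  have basis: "closed_span scale_ell2 (\<lambda>n. scale_ell2 (c n) (unit_ell2 n)) = UNIV"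
    using orthogonal_basis_scaled_unit[of c, OF c] unfolding orthogonal_basis_def by blast
  have image: "S (scale_ell2 (c n) (unit_ell2 n)) = smul (c n) (y n)" for n
    by (simp only: scale unit)
  have pos: "sqrt (1 - \<eta>) > 0" "sqrt (1 + \<eta>) \<ge> 0" using \<eta> by auto
  show ?thesis
    by (rule equivalent_seq_of_embedding[OF hilbert_space_axioms hilbert_space_ell2 add scale pos
          lower' upper' basis image])
qed

end

section \<open>Assembling the subsequence and its orthogonal basis\<close>

theorem theorem10:
  fixes smul :: "'k::real_or_complex \<Rightarrow> 'a::banach \<Rightarrow> 'a"
    and ip :: "'a \<Rightarrow> 'a \<Rightarrow> 'k"
    and x :: "nat \<Rightarrow> 'a"
    and \<epsilon> :: real
  assumes "hilbert_space smul ip"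
    and "infinite_dimensional smul"
    and "separable_space (euclidean :: 'a topology)"
    and "frame ip x"
    and "\<epsilon> > 0"
  shows "\<exists>(r :: nat \<Rightarrow> nat) (e :: nat \<Rightarrow> 'k ell2).
           strict_mono r \<and> orthogonal_basis scale_ell2 ip_ell2 e \<and>
           equivalent_seq (1 + \<epsilon>) smul (x \<circ> r) scale_ell2 e"
proof -
  interpret hilbert_space smul ip by fact
  \<comment> \<open>This is the solution of (1 + \<eta>) / (1 - \<eta>) = 1 + \<epsilon>.\<close>
  define \<eta> where "\<eta> = \<epsilon> / (2 + \<epsilon>)"
  have \<eta>: "0 < \<eta>" "\<eta> < 1" using \<open>\<epsilon> > 0\<close> by (auto simp: \<eta>_def)
  obtain r where r: "strict_mono r" "\<And>n. x (r n) \<noteq> 0"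
    "\<And>i n. i < n \<Longrightarrow>
      norm (ip (sgn (x (r i))) (sgn (x (r n)))) \<le> \<eta> / (2 * Suc n * 2 ^ Suc n)"
    by (rule frame_almost_orthogonal_subsequence[OF assms(2,4),
          where \<delta>="\<lambda>n. \<eta> / (2 * Suc n * 2 ^ Suc n)"])
       (use \<eta> in \<open>auto intro!: divide_pos_pos add_pos_nonneg\<close>)
  \<comment> \<open>These factors undo the normalisation: scaling \<open>sgn (x (r n))\<close> by
    \<open>c n\<close> restores \<open>x (r n)\<close>.\<close>
  define c where "c n = (of_real (norm (x (r n))) :: 'k)" for n
  have c: "c n \<noteq> 0" for n using r(2) by (simp add: c_def)
  have xr: "(\<lambda>n. smul (c n) (sgn (x (r n)))) = x \<circ> r"
    using r(2) by (auto simp: c_def scale_of_real sgn_div_norm)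
  have "(1 + \<eta>) / (1 - \<eta>) = 1 + \<epsilon>"
    using \<open>\<epsilon> > 0\<close> by (simp add: \<eta>_def field_simps)
  then have "sqrt (1 + \<eta>) / sqrt (1 - \<eta>) = sqrt (1 + \<epsilon>)"
    by (metis real_sqrt_divide)
  also have "\<dots> \<le> 1 + \<epsilon>"
    using \<open>\<epsilon> > 0\<close> by (intro real_le_lsqrt) (auto simp: power2_eq_square algebra_simps)
  finally have "sqrt (1 + \<eta>) / sqrt (1 - \<eta>) \<le> 1 + \<epsilon>" .
  moreover have "equivalent_seq (sqrt (1 + \<eta>) / sqrt (1 - \<eta>)) smul (x \<circ> r)
      scale_ell2 (\<lambda>n. scale_ell2 (c n) (unit_ell2 n))"
    unfolding xr[symmetric]
    by (rule almost_orthonormal_equivalent) (use r \<eta> c in \<open>auto simp: norm_sgn\<close>)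
  ultimately have "equivalent_seq (1 + \<epsilon>) smul (x \<circ> r)
      scale_ell2 (\<lambda>n. scale_ell2 (c n) (unit_ell2 n))"
    unfolding equivalent_seq_def by (meson order_trans)
  with r(1) orthogonal_basis_scaled_unit[of c, OF c] show ?thesis by blast
qed

end
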